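(* A (not necessarily finite) poset $L$ is a well separated $\kappa$-lattice if and only if it is isomorphic to $\operatorname{Pairs}(\to)$ for a two-acyclic factorization system $(S,\to,\twoheadrightarrow,\hookrightarrow)$. If so, $(S,\to,\twoheadrightarrow,\hookrightarrow)$ is isomorphic to $(\operatorname{Ji}^cL,\to_L,\twoheadrightarrow_L,\hookrightarrow_L)$ (there is a bijection of underlying sets carrying each relation to the corresponding relation), and the map $$x\mapsto\bigl(\{j\in\operatorname{Ji}^cL: j\le x\},\ \kappa^d(\{m\in\operatorname{Mi}^cL: m\ge x\})\bigr)$$ is an isomorphism from $L$ to $\operatorname{Pairs}(\to_L)$, with inverse $(X,Y)\mapsto\bigvee X=\bigwedge\kappa(Y)$.
   Context: Lattices: A complete lattice is a poset in which every subset has a meet and a join. An element $j$ of a complete lattice $L$ is completely join-irreducible if $j=\bigvee X$ implies $j\in X$ for all subsets $X\subseteq L$; equivalently there is an element $j_*$ such that $x<j$ iff $x\le j_*$. Dually $m$ is completely meet-irreducible if $m=\bigwedge X$ implies $m\in X$; equivalently there is $m^*$ such that $x>m$ iff $x\ge m^*$. $\operatorname{Ji}^cL$ and $\operatorname{Mi}^cL$ are the sets of completely join-irreducible and completely meet-irreducible elements. A complete lattice is bi-spatial if every element is a join of completely join-irreducible elements and also a meet of completely meet-irreducible elements. A $\kappa$-lattice is a complete, bi-spatial lattice $L$ for which there are inverse bijections $\kappa:\operatorname{Ji}^cL\to\operatorname{Mi}^cL$ and $\kappa^d:\operatorname{Mi}^cL\to\operatorname{Ji}^cL$ such that $\kappa(j)$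 is the maximum element of $\{y: j\wedge y=j_*\}$ and $\kappa^d(m)$ is the minimum element of $\{x: m\vee x=m^*\}$. A $\kappa$-lattice is well separated if whenever $z_1\not\le z_2$, there is some $j\in\operatorname{Ji}^cL$ with $z_1\ge j$ and $\kappa(j)\ge z_2$. In a $\kappa$-lattice $L$ define relations on $\operatorname{Ji}^cL$: $i\to_L j$ iff $i\not\le\kappa(j)$; $i\twoheadrightarrow_L j$ iff $i\ge j$; $i\hookrightarrow_L j$ iff $\kappa(i)\ge\kappa(j)$. Factorization systems: For a binary relation $\to$ on a set $S$ and $X\subseteq S$, put $X^\perp=\{y\in S: x\not\to y\ \forall x\in X\}$ and ${}^\perp X=\{y\in S: y\not\to x\ \forall x\in X\}$. A maximal orthogonal pair is a pair $(X,Y)$ of subsets of $S$ with $Y=X^\perp$ and $X={}^\perp Y$. $\operatorname{Pairs}(\to)$ is the set of maximal orthogonal pairs, partially ordered by containment of first components (equivalently reverse containment of second components). For a reflexive relation $\to$ on $S$, $\operatorname{Fact}(\to)=(\twoheadrightarrow,\hookrightarrow)$, where $x\twoheadrightarrow y$ iff for all $z$, $y\to z$ implies $x\to z$, and $x\hookrightarrow y$ iff for all $z$, $z\to x$ implies $z\to y$. For preorders $\twoheadrightarrow,\hookrightarrow$ on $S$, $\operatorname{Mult}(\twoheadrightarrow,\hookrightarrow)$ is the relation relating $x$ to $z$ iff there is $y\in S$ with $x\twoheadrightarrow y\hookrightarrow z$. A factorization system is a tuple $(S,\to,\twoheadrightarrow,\hookrightarrow)$ ($S$ possibly infinite) with $\to$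 a reflexive relation on $S$, $\operatorname{Fact}(\to)=(\twoheadrightarrow,\hookrightarrow)$ and $\operatorname{Mult}(\twoheadrightarrow,\hookrightarrow)=\to$. It is two-acyclic if it satisfies the order condition ($x\twoheadrightarrow y\twoheadrightarrow x$ implies $x=y$, and $x\hookrightarrow y\hookrightarrow x$ implies $x=y$) and the brick condition ($x\twoheadrightarrow y\hookrightarrow x$ implies $x=y$). *)

theory Defs
  imports "HOL-Algebra.Complete_Lattice"
begin

section \<open>Well separated \<open>\<kappa>\<close>-lattices\<close>

text \<open>
  Posets are records \<open>L\<close> with \<open>partial_order L\<close>; the carrier may be any set, finite or infinite.
  The notions in this section are meaningful only when \<open>L\<close> is a complete lattice.
  The empty set is allowed as \<open>X\<close> below, so the bottom (top) element is not completely
  join-irreducible (meet-irreducible).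
\<close>

definition cji :: "('a, 'm) gorder_scheme \<Rightarrow> 'a set" where
  "cji L = {j \<in> carrier L. \<forall>X \<subseteq> carrier L. j = \<Squnion>\<^bsub>L\<^esub>X \<longrightarrow> j \<in> X}"

definition cmi :: "('a, 'm) gorder_scheme \<Rightarrow> 'a set" where
  "cmi L = {m \<in> carrier L. \<forall>X \<subseteq> carrier L. m = \<Sqinter>\<^bsub>L\<^esub>X \<longrightarrow> m \<in> X}"

text \<open>The elements \<open>j\<^sub>*\<close> and \<open>m\<^sup>*\<close>.\<close>

definition lower_cover :: "('a, 'm) gorder_scheme \<Rightarrow> 'a \<Rightarrow> 'a" where
  "lower_cover L j =
    (THE y. y \<in> carrier L \<and> (\<forall>x \<in> carrier L. x \<sqsubset>\<^bsub>L\<^esub> j \<longleftrightarrow> x \<sqsubseteq>\<^bsub>L\<^esub> y))"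

definition upper_cover :: "('a, 'm) gorder_scheme \<Rightarrow> 'a \<Rightarrow> 'a" where
  "upper_cover L m =
    (THE y. y \<in> carrier L \<and> (\<forall>x \<in> carrier L. m \<sqsubset>\<^bsub>L\<^esub> x \<longleftrightarrow> y \<sqsubseteq>\<^bsub>L\<^esub> x))"

definition kappa_bijections ::
  "('a, 'm) gorder_scheme \<Rightarrow> ('a \<Rightarrow> 'a) \<Rightarrow> ('a \<Rightarrow> 'a) \<Rightarrow> bool" where
  "kappa_bijections L k kd \<longleftrightarrow>
     bij_betw k (cji L) (cmi L) \<and> bij_betw kd (cmi L) (cji L) \<and>
     (\<forall>j \<in> cji L. kd (k j) = j) \<and> (\<forall>m \<in> cmi L. k (kd m) = m) \<and>
     (\<forall>j \<in> cji L. greatest L (k j) {y \<in> carrier L. j \<sqinter>\<^bsub>L\<^esub> y = lower_cover L j}) \<and>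
     (\<forall>m \<in> cmi L. least L (kd m) {x \<in> carrier L. m \<squnion>\<^bsub>L\<^esub> x = upper_cover L m})"

locale kappa_lattice = complete_lattice L for L (structure) +
  assumes join_spatial: "x \<in> carrier L \<Longrightarrow> \<exists>X \<subseteq> cji L. x = \<Squnion>X"
    and meet_spatial: "x \<in> carrier L \<Longrightarrow> \<exists>X \<subseteq> cmi L. x = \<Sqinter>X"
    and kappa_exists: "\<exists>k kd. kappa_bijections L k kd"

text \<open>
  The maps required to exist above are unique (see the two lemmas below); these constants
  name them.
\<close>

definition kappa :: "('a, 'm) gorder_scheme \<Rightarrow> 'a \<Rightarrow> 'a" where
  "kappa L j = (THE m. greatest L m {y \<in> carrier L. j \<sqinter>\<^bsub>L\<^esub> y = lower_cover L j})"

definition kappa_dual :: "('a, 'm) gorder_scheme \<Rightarrow> 'a \<Rightarrow> 'a" where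
  "kappa_dual L m = (THE j. least L j {x \<in> carrier L. m \<squnion>\<^bsub>L\<^esub> x = upper_cover L m})"

lemma (in partial_order) kappa_eq:
  assumes "kappa_bijections L k kd" "j \<in> cji L"
  shows "kappa L j = k j"
  using assms unfolding kappa_def kappa_bijections_def
  by (intro the_equality) (auto intro: greatest_unique)

lemma (in partial_order) kappa_dual_eq:
  assumes "kappa_bijections L k kd" "m \<in> cmi L"
  shows "kappa_dual L m = kd m"
  using assms unfolding kappa_dual_def kappa_bijections_def
  by (intro the_equality) (auto intro: least_unique)

locale well_separated_kappa_lattice = kappa_lattice +
  assumes well_separated: "\<lbrakk>x \<in> carrier L; y \<in> carrier L; \<not> x \<sqsubseteq> y\<rbrakk>
      \<Longrightarrow> \<exists>j \<in> cji L. j \<sqsubseteq> x \<and> y \<sqsubseteq> kappa L j"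

definition arrow_rel :: "('a, 'm) gorder_scheme \<Rightarrow> 'a rel" where
  "arrow_rel L = {(i, j) \<in> cji L \<times> cji L. \<not> i \<sqsubseteq>\<^bsub>L\<^esub> kappa L j}"

definition onto_rel :: "('a, 'm) gorder_scheme \<Rightarrow> 'a rel" where
  "onto_rel L = {(i, j) \<in> cji L \<times> cji L. j \<sqsubseteq>\<^bsub>L\<^esub> i}"

definition into_rel :: "('a, 'm) gorder_scheme \<Rightarrow> 'a rel" where
  "into_rel L = {(i, j) \<in> cji L \<times> cji L. kappa L j \<sqsubseteq>\<^bsub>L\<^esub> kappa L i}"


section \<open>Factorization systems and maximal orthogonal pairs\<close>

text \<open>A binary relation on \<open>S\<close> is a set \<open>r \<subseteq> S \<times> S\<close>.\<close>

definition right_perp :: "'s set \<Rightarrow> 's rel \<Rightarrow> 's set \<Rightarrow> 's set" where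
  "right_perp S r X = {y \<in> S. \<forall>x \<in> X. (x, y) \<notin> r}"

definition left_perp :: "'s set \<Rightarrow> 's rel \<Rightarrow> 's set \<Rightarrow> 's set" where
  "left_perp S r X = {y \<in> S. \<forall>x \<in> X. (y, x) \<notin> r}"

definition max_orth_pairs :: "'s set \<Rightarrow> 's rel \<Rightarrow> ('s set \<times> 's set) set" where
  "max_orth_pairs S r =
    {(X, Y). X \<subseteq> S \<and> Y \<subseteq> S \<and> Y = right_perp S r X \<and> X = left_perp S r Y}"

definition Pairs :: "'s set \<Rightarrow> 's rel \<Rightarrow> ('s set \<times> 's set) gorder" where
  "Pairs S r = \<lparr>carrier = max_orth_pairs S r, eq = (=), le = (\<lambda>p q. fst p \<subseteq> fst q)\<rparr>"

definition Fact :: "'s set \<Rightarrow> 's rel \<Rightarrow> 's rel \<times> 's rel" where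
  "Fact S r =
    ({(x, y) \<in> S \<times> S. \<forall>z \<in> S. (y, z) \<in> r \<longrightarrow> (x, z) \<in> r},
     {(x, y) \<in> S \<times> S. \<forall>z \<in> S. (z, x) \<in> r \<longrightarrow> (z, y) \<in> r})"

definition Mult :: "'s set \<Rightarrow> 's rel \<Rightarrow> 's rel \<Rightarrow> 's rel" where
  "Mult S onto into = {(x, z) \<in> S \<times> S. \<exists>y \<in> S. (x, y) \<in> onto \<and> (y, z) \<in> into}"

locale factorization_system =
  fixes S :: "'s set" and r onto into :: "'s rel"
  assumes rel_subset: "r \<subseteq> S \<times> S"
    and rel_refl: "refl_on S r"
    and Fact_eq: "Fact S r = (onto, into)"
    and Mult_eq: "Mult S onto into = r"

locale two_acyclic_factorization_system = factorization_system +
  assumes onto_order: "\<lbrakk>(x, y) \<in> onto; (y, x) \<in> onto\<rbrakk> \<Longrightarrow> x = y"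
    and into_order: "\<lbrakk>(x, y) \<in> into; (y, x) \<in> into\<rbrakk> \<Longrightarrow> x = y"
    and brick: "\<lbrakk>(x, y) \<in> onto; (y, x) \<in> into\<rbrakk> \<Longrightarrow> x = y"


section \<open>Isomorphisms\<close>

definition poset_iso ::
  "('a, 'm) gorder_scheme \<Rightarrow> ('b, 'n) gorder_scheme \<Rightarrow> ('a \<Rightarrow> 'b) \<Rightarrow> bool" where
  "poset_iso L M f \<longleftrightarrow> order_emb L M f \<and> bij_betw f (carrier L) (carrier M)"

definition poset_isomorphic ::
  "('a, 'm) gorder_scheme \<Rightarrow> ('b, 'n) gorder_scheme \<Rightarrow> bool" where
  "poset_isomorphic L M \<longleftrightarrow> (\<exists>f. poset_iso L M f)"

definition rel_preserving :: "('s \<Rightarrow> 't) \<Rightarrow> 's set \<Rightarrow> 's rel \<Rightarrow> 't rel \<Rightarrow> bool" where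
  "rel_preserving f S r r' \<longleftrightarrow> (\<forall>x \<in> S. \<forall>y \<in> S. (x, y) \<in> r \<longleftrightarrow> (f x, f y) \<in> r')"

definition system_isomorphic ::
  "'s set \<times> 's rel \<times> 's rel \<times> 's rel \<Rightarrow> 't set \<times> 't rel \<times> 't rel \<times> 't rel \<Rightarrow> bool" where
  "system_isomorphic = (\<lambda>(S, r, onto, into) (T, r', onto', into').
     \<exists>f. bij_betw f S T \<and> rel_preserving f S r r' \<and>
         rel_preserving f S onto onto' \<and> rel_preserving f S into into')"

definition pair_of :: "('a, 'm) gorder_scheme \<Rightarrow> 'a \<Rightarrow> 'a set \<times> 'a set" where
  "pair_of L x = ({j \<in> cji L. j \<sqsubseteq>\<^bsub>L\<^esub> x}, kappa_dual L ` {m \<in> cmi L. x \<sqsubseteq>\<^bsub>L\<^esub> m})"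

end

theory Submission
  imports Defs
begin

text \<open>
  A two-acyclic factorization system is recovered from \<open>L \<cong> Pairs(\<rightarrow>)\<close> inside \<open>L\<close> itself:
  \<open>s \<in> S\<close> gives the elements \<open>J s\<close> and \<open>M s\<close> of \<open>L\<close> corresponding to the maximal orthogonal pairs
  generated by \<open>{s}\<close> on the left and on the right.  The \<open>J s\<close> are join-dense, the \<open>M s\<close> are
  meet-dense, and \<open>J s \<sqsubseteq> M t\<close> iff \<open>s \<not>\<rightarrow> t\<close>.  Then \<open>\<twoheadrightarrow>\<close> is the reverse order on the \<open>J s\<close> and
  \<open>\<hookrightarrow>\<close> the reverse order on the \<open>M s\<close>, and interpolating \<open>t \<rightarrow> s\<close> as \<open>t \<twoheadrightarrow> u \<hookrightarrow> s\<close> forces, by the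
  brick condition, \<open>J s\<close> to have lower cover \<open>J s \<sqinter> M s\<close> and \<open>\<kappa>(J s) = M s\<close>; the interpolation
  property itself is well-separatedness.

  Conversely, in a well separated \<open>\<kappa>\<close>-lattice bi-spatiality identifies \<open>Fact(\<rightarrow>\<^sub>L)\<close> and
  well-separatedness gives the factorizations; reflexivity amounts to \<open>j \<not>\<sqsubseteq> \<kappa>(j)\<close>, and the brick
  condition holds because \<open>x \<sqsubset> j\<close> implies \<open>x \<sqsubseteq> \<kappa>(j)\<close>.
\<close>

section \<open>Maximal orthogonal pairs\<close>

lemma right_perp_antimono: "X \<subseteq> X' \<Longrightarrow> right_perp S r X' \<subseteq> right_perp S r X"
  by (auto simp: right_perp_def)

lemma left_perp_antimono: "X \<subseteq> X' \<Longrightarrow> left_perp S r X' \<subseteq> left_perp S r X"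
  by (auto simp: left_perp_def)

lemma subset_left_perp_right_perp: "X \<subseteq> S \<Longrightarrow> X \<subseteq> left_perp S r (right_perp S r X)"
  by (auto simp: left_perp_def right_perp_def)

text \<open>The two perps form a Galois connection, so taking the right perp of the closure of
  \<open>X\<close> gives back the right perp of \<open>X\<close>.\<close>

lemma max_orth_pair_generated:
  assumes "X \<subseteq> S"
  shows "(left_perp S r (right_perp S r X), right_perp S r X) \<in> max_orth_pairs S r"
  using assms by (auto simp: max_orth_pairs_def left_perp_def right_perp_def)

lemma max_orth_pairsD:
  assumes "p \<in> max_orth_pairs S r"
  shows "fst p \<subseteq> S" "snd p \<subseteq> S" "snd p = right_perp S r (fst p)" "fst p = left_perp S r (snd p)"
  using assms by (auto simp: max_orth_pairs_def)

lemma max_orth_pairs_closed: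
  "p \<in> max_orth_pairs S r \<Longrightarrow> left_perp S r (right_perp S r (fst p)) = fst p"
  using max_orth_pairsD(3,4) by metis

lemma carrier_Pairs [simp]: "carrier (Pairs S r) = max_orth_pairs S r"
  by (simp add: Pairs_def)

lemma le_Pairs [simp]: "p \<sqsubseteq>\<^bsub>Pairs S r\<^esub> q \<longleftrightarrow> fst p \<subseteq> fst q"
  by (simp add: Pairs_def)

lemma max_orth_pairs_eqI:
  assumes "p \<in> max_orth_pairs S r" "q \<in> max_orth_pairs S r" "fst p = fst q"
  shows "p = q"
  using assms max_orth_pairsD(3) by (metis prod_eqI)

lemma partial_order_Pairs: "partial_order (Pairs S r)"
  by unfold_locales (simp_all add: Pairs_def max_orth_pairs_eqI subset_trans)

section \<open>From \<open>\<kappa>\<close>-lattices to factorization systems\<close>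

lemma (in partial_order) lower_cover_eqI:
  assumes "y \<in> carrier L" "\<And>x. x \<in> carrier L \<Longrightarrow> x \<sqsubset> j \<longleftrightarrow> x \<sqsubseteq> y"
  shows "lower_cover L j = y"
  unfolding lower_cover_def
  using assms by (intro the_equality) (auto intro!: le_antisym)

text \<open>The lower cover is the join of everything strictly below \<open>j\<close>.
  Irreducibility keeps this join from being \<open>j\<close>, so it is itself strictly below
  \<open>j\<close>.\<close>

lemma (in complete_lattice) lower_cover_cji:
  assumes j: "j \<in> cji L"
  shows "lower_cover L j \<in> carrier L"
    and "x \<in> carrier L \<Longrightarrow> x \<sqsubset> j \<longleftrightarrow> x \<sqsubseteq> lower_cover L j"
proof -
  let ?B = "{x \<in> carrier L. x \<sqsubset> j}"
  have jc: "j \<in> carrier L" and jX: "\<And>X. X \<subseteq> carrier L \<Longrightarrow> j = \<Squnion>X \<Longrightarrow> j \<in> X"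
    using j by (auto simp: cji_def)
  have B: "?B \<subseteq> carrier L" by auto
  have "\<Squnion>?B \<sqsubseteq> j"
    using jc by (intro sup_least) (auto simp: lless_eq)
  moreover have "j \<noteq> \<Squnion>?B"
    using jX[OF B] by (auto simp: lless_eq)
  ultimately have less: "x \<sqsubset> j \<longleftrightarrow> x \<sqsubseteq> \<Squnion>?B" if "x \<in> carrier L" for x
    using that jc sup_upper[OF B, of x] sup_closed[OF B]
    by (auto simp: lless_eq intro: le_trans)
  moreover have "\<Squnion>?B \<in> carrier L"
    by (rule sup_closed[OF B])
  ultimately have "lower_cover L j = \<Squnion>?B"
    by (intro lower_cover_eqI)
  then show "lower_cover L j \<in> carrier L"
    and "x \<in> carrier L \<Longrightarrow> x \<sqsubset> j \<longleftrightarrow> x \<sqsubseteq> lower_cover L j"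
    using less sup_closed[OF B] by auto
qed

section \<open>The map kappa and the two forms of density\<close>

context kappa_lattice
begin

lemma kappa_bijections_kappa: "kappa_bijections L (kappa L) (kappa_dual L)"
proof -
  obtain k kd where k: "kappa_bijections L k kd"
    using kappa_exists by blast
  have eq: "kappa L j = k j" if "j \<in> cji L" for j
    by (rule kappa_eq[OF k that])
  have eqd: "kappa_dual L m = kd m" if "m \<in> cmi L" for m
    by (rule kappa_dual_eq[OF k that])
  have "bij_betw (kappa L) (cji L) (cmi L) \<longleftrightarrow> bij_betw k (cji L) (cmi L)"
    "bij_betw (kappa_dual L) (cmi L) (cji L) \<longleftrightarrow> bij_betw kd (cmi L) (cji L)"
    by (intro bij_betw_cong eq eqd; assumption)+
  with k show ?thesis
    unfolding kappa_bijections_def using eq eqd by (auto dest: bij_betwE)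
qed

lemma bij_kappa: "bij_betw (kappa L) (cji L) (cmi L)"
  and kappa_dual_kappa: "j \<in> cji L \<Longrightarrow> kappa_dual L (kappa L j) = j"
  and kappa_greatest:
    "j \<in> cji L \<Longrightarrow> greatest L (kappa L j) {y \<in> carrier L. j \<sqinter> y = lower_cover L j}"
  using kappa_bijections_kappa unfolding kappa_bijections_def by simp_all

lemma cji_closed [simp]: "j \<in> cji L \<Longrightarrow> j \<in> carrier L"
  by (simp add: cji_def)

lemma cmi_closed [simp]: "m \<in> cmi L \<Longrightarrow> m \<in> carrier L"
  by (simp add: cmi_def)

lemma kappa_closed [simp]: "j \<in> cji L \<Longrightarrow> kappa L j \<in> carrier L"
  using bij_betwE[OF bij_kappa] by auto

lemma cmi_eq_image_kappa: "cmi L = kappa L ` cji L"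
  using bij_kappa by (simp add: bij_betw_def)

lemma meet_kappa: "j \<in> cji L \<Longrightarrow> j \<sqinter> kappa L j = lower_cover L j"
  using kappa_greatest by (auto simp: greatest_def)

lemma less_imp_le_kappa:
  assumes "j \<in> cji L" "x \<in> carrier L" "x \<sqsubset> j"
  shows "x \<sqsubseteq> kappa L j"
proof -
  have "x \<sqsubseteq> j \<sqinter> kappa L j"
    using assms lower_cover_cji by (simp add: meet_kappa)
  moreover have "j \<sqinter> kappa L j \<sqsubseteq> kappa L j"
    using assms by (simp add: meet_right)
  ultimately show ?thesis
    using assms le_trans by (meson cji_closed kappa_closed meet_closed)
qed

text \<open>Otherwise \<open>j\<close> would lie below its meet with \<open>kappa L j\<close>, which
  is its own lower cover. This is the reflexivity of \<open>arrow_rel L\<close>.\<close>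

lemma not_le_kappa:
  assumes j: "j \<in> cji L"
  shows "\<not> j \<sqsubseteq> kappa L j"
proof
  assume "j \<sqsubseteq> kappa L j"
  then have "j \<sqsubseteq> lower_cover L j"
    using j meet_le[of j j "kappa L j"] by (simp add: meet_kappa)
  then have "j \<sqsubset> j"
    using j lower_cover_cji by simp
  then show False
    by (simp add: lless_eq)
qed

lemma cji_dense:
  assumes "x \<in> carrier L" "y \<in> carrier L" "\<And>j. j \<in> cji L \<Longrightarrow> j \<sqsubseteq> x \<Longrightarrow> j \<sqsubseteq> y"
  shows "x \<sqsubseteq> y"
proof -
  obtain X where X: "X \<subseteq> cji L" "x = \<Squnion>X"
    using join_spatial[OF assms(1)] by blast
  have "X \<subseteq> carrier L"
    using X by auto
  then show ?thesis
    using X assms sup_upper sup_least by (metis subsetD)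
qed

text \<open>Meet-spatiality, with the completely meet-irreducible elements indexed by
  \<open>cji L\<close> through the bijection \<open>kappa L\<close>.\<close>

lemma kappa_dense:
  assumes "x \<in> carrier L" "y \<in> carrier L" "\<And>j. j \<in> cji L \<Longrightarrow> y \<sqsubseteq> kappa L j \<Longrightarrow> x \<sqsubseteq> kappa L j"
  shows "x \<sqsubseteq> y"
proof -
  obtain X where X: "X \<subseteq> cmi L" "y = \<Sqinter>X"
    using meet_spatial[OF assms(2)] by blast
  have Xc: "X \<subseteq> carrier L"
    using X by auto
  have "x \<sqsubseteq> m" if m: "m \<in> X" for m
  proof -
    obtain j where "j \<in> cji L" "m = kappa L j"
      using m X(1) cmi_eq_image_kappa by blast
    then show ?thesis
      using assms(3) inf_lower[OF Xc m] X(2) by simp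
  qed
  then show ?thesis
    using X Xc assms inf_greatest by auto
qed

lemma kappa_dense_iff:
  assumes "x \<in> carrier L" "y \<in> carrier L"
  shows "x \<sqsubseteq> y \<longleftrightarrow> (\<forall>j \<in> cji L. y \<sqsubseteq> kappa L j \<longrightarrow> x \<sqsubseteq> kappa L j)"
proof
  assume "x \<sqsubseteq> y"
  then show "\<forall>j \<in> cji L. y \<sqsubseteq> kappa L j \<longrightarrow> x \<sqsubseteq> kappa L j"
    using assms le_trans[of x y] by simp
qed (use assms kappa_dense[of x y] in blast)

lemma cji_dense_iff:
  assumes "x \<in> carrier L" "y \<in> carrier L"
  shows "x \<sqsubseteq> y \<longleftrightarrow> (\<forall>j \<in> cji L. j \<sqsubseteq> x \<longrightarrow> j \<sqsubseteq> y)"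
proof
  assume "x \<sqsubseteq> y"
  then show "\<forall>j \<in> cji L. j \<sqsubseteq> x \<longrightarrow> j \<sqsubseteq> y"
    using assms le_trans[of _ x y] by simp
qed (use assms cji_dense[of x y] in blast)

text \<open>Each clause of \<open>Fact\<close> is, in contrapositive form, a comparison tested on a
  dense family: the elements \<open>kappa L z\<close> for \<open>onto_rel\<close>, the elements of
  \<open>cji L\<close> for \<open>into_rel\<close>.\<close>

lemma Fact_arrow_rel: "Fact (cji L) (arrow_rel L) = (onto_rel L, into_rel L)"
proof -
  have "j \<sqsubseteq> i \<longleftrightarrow> (\<forall>z \<in> cji L. (j, z) \<in> arrow_rel L \<longrightarrow> (i, z) \<in> arrow_rel L)"
    if "i \<in> cji L" "j \<in> cji L" for i j
    using that by (subst kappa_dense_iff) (auto simp: arrow_rel_def)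
  moreover have "kappa L j \<sqsubseteq> kappa L i
      \<longleftrightarrow> (\<forall>z \<in> cji L. (z, i) \<in> arrow_rel L \<longrightarrow> (z, j) \<in> arrow_rel L)"
    if "i \<in> cji L" "j \<in> cji L" for i j
    using that by (subst cji_dense_iff) (auto simp: arrow_rel_def)
  ultimately show ?thesis
    unfolding Fact_def onto_rel_def into_rel_def by blast
qed

section \<open>Maximal orthogonal pairs of the arrow relation\<close>

lemma right_perp_arrow_rel:
  assumes "X \<subseteq> cji L"
  shows "right_perp (cji L) (arrow_rel L) X = {j \<in> cji L. \<Squnion>X \<sqsubseteq> kappa L j}"
proof -
  have Xc: "X \<subseteq> carrier L"
    using assms by auto
  have "(\<forall>i \<in> X. i \<sqsubseteq> kappa L j) \<longleftrightarrow> \<Squnion>X \<sqsubseteq> kappa L j" if "j \<in> cji L" for j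
    using that Xc sup_upper[OF Xc] sup_closed[OF Xc] sup_least[OF Xc, of "kappa L j"]
    by (meson kappa_closed le_trans subsetD)
  moreover have "right_perp (cji L) (arrow_rel L) X = {j \<in> cji L. \<forall>i \<in> X. i \<sqsubseteq> kappa L j}"
    using assms unfolding right_perp_def arrow_rel_def by blast
  ultimately show ?thesis
    by auto
qed

lemma left_perp_arrow_rel:
  assumes "x \<in> carrier L"
  shows "left_perp (cji L) (arrow_rel L) {j \<in> cji L. x \<sqsubseteq> kappa L j} = {j \<in> cji L. j \<sqsubseteq> x}"
proof -
  have "j \<sqsubseteq> x \<longleftrightarrow> (\<forall>i \<in> cji L. x \<sqsubseteq> kappa L i \<longrightarrow> j \<sqsubseteq> kappa L i)" if "j \<in> cji L" for j
    using that assms by (intro kappa_dense_iff) simp_all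
  then show ?thesis
    by (simp add: set_eq_iff left_perp_def arrow_rel_def Ball_def imp_conjL cong: conj_cong)
qed

lemma sup_cji_below:
  assumes "x \<in> carrier L"
  shows "\<Squnion>{j \<in> cji L. j \<sqsubseteq> x} = x"
proof (rule le_antisym)
  have X: "{j \<in> cji L. j \<sqsubseteq> x} \<subseteq> carrier L"
    by auto
  show "\<Squnion>{j \<in> cji L. j \<sqsubseteq> x} \<in> carrier L"
    by (rule sup_closed[OF X])
  then show "x \<sqsubseteq> \<Squnion>{j \<in> cji L. j \<sqsubseteq> x}"
    using assms sup_upper[OF X] by - (rule cji_dense, auto)
  show "\<Squnion>{j \<in> cji L. j \<sqsubseteq> x} \<sqsubseteq> x"
    using X assms by (intro sup_least) auto
qed (fact assms)

lemma inf_kappa_above: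
  assumes "x \<in> carrier L"
  shows "\<Sqinter>(kappa L ` {j \<in> cji L. x \<sqsubseteq> kappa L j}) = x"
proof (rule le_antisym)
  let ?Y = "kappa L ` {j \<in> cji L. x \<sqsubseteq> kappa L j}"
  have Y: "?Y \<subseteq> carrier L"
    by auto
  show "\<Sqinter>?Y \<in> carrier L"
    by (rule inf_closed[OF Y])
  then show "\<Sqinter>?Y \<sqsubseteq> x"
    using assms inf_lower[OF Y] by - (rule kappa_dense, auto)
  show "x \<sqsubseteq> \<Sqinter>?Y"
    using Y assms by (intro inf_greatest) auto
qed (fact assms)

text \<open>Since \<open>kappa_dual L\<close> inverts \<open>kappa L\<close>, the second component
  can be indexed by \<open>cji L\<close>, the form in which the perp computations apply.\<close>

lemma pair_of_eq:
  "pair_of L x = ({j \<in> cji L. j \<sqsubseteq> x}, {j \<in> cji L. x \<sqsubseteq> kappa L j})"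
proof -
  have "{m \<in> cmi L. x \<sqsubseteq> m} = kappa L ` {j \<in> cji L. x \<sqsubseteq> kappa L j}"
    unfolding cmi_eq_image_kappa by blast
  moreover have "(\<lambda>j. kappa_dual L (kappa L j)) ` {j \<in> cji L. x \<sqsubseteq> kappa L j}
      = id ` {j \<in> cji L. x \<sqsubseteq> kappa L j}"
    by (intro image_cong) (simp_all add: kappa_dual_kappa)
  ultimately show ?thesis
    by (simp add: pair_of_def image_image)
qed

lemma pair_of_closed:
  assumes "x \<in> carrier L"
  shows "pair_of L x \<in> max_orth_pairs (cji L) (arrow_rel L)"
proof -
  have "right_perp (cji L) (arrow_rel L) {j \<in> cji L. j \<sqsubseteq> x} = {j \<in> cji L. x \<sqsubseteq> kappa L j}"
    using assms right_perp_arrow_rel[of "{j \<in> cji L. j \<sqsubseteq> x}"] by (simp add: sup_cji_below)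
  then show ?thesis
    unfolding pair_of_eq max_orth_pairs_def using left_perp_arrow_rel[OF assms] by simp
qed

text \<open>The perps of \<open>X\<close> depend only on its join, so the pair is recovered from
  that join. This yields both surjectivity of \<open>pair_of L\<close> and the formula for its
  inverse.\<close>

lemma max_orth_pairs_arrow_rel:
  assumes "(X, Y) \<in> max_orth_pairs (cji L) (arrow_rel L)"
  shows "\<Squnion>X \<in> carrier L" "pair_of L (\<Squnion>X) = (X, Y)" "\<Squnion>X = \<Sqinter>(kappa L ` Y)"
proof -
  have X: "X \<subseteq> cji L" and Y: "Y = right_perp (cji L) (arrow_rel L) X"
    and X': "X = left_perp (cji L) (arrow_rel L) Y"
    using max_orth_pairsD[OF assms] by simp_all
  show c: "\<Squnion>X \<in> carrier L"
    using X by (intro sup_closed) auto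
  have Y': "Y = {j \<in> cji L. \<Squnion>X \<sqsubseteq> kappa L j}"
    using Y right_perp_arrow_rel[OF X] by simp
  show "pair_of L (\<Squnion>X) = (X, Y)"
    unfolding pair_of_eq using Y' X' left_perp_arrow_rel[OF c] by simp
  show "\<Squnion>X = \<Sqinter>(kappa L ` Y)"
    using inf_kappa_above[OF c] Y' by simp
qed

lemma poset_iso_pair_of: "poset_iso L (Pairs (cji L) (arrow_rel L)) (pair_of L)"
proof -
  have le: "fst (pair_of L x) \<subseteq> fst (pair_of L y) \<longleftrightarrow> x \<sqsubseteq> y"
    if "x \<in> carrier L" "y \<in> carrier L" for x y
    using that by (subst cji_dense_iff) (auto simp: pair_of_eq)
  then have "inj_on (pair_of L) (carrier L)"
    by (intro inj_onI) (metis le_antisym subset_refl)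
  moreover have "pair_of L ` carrier L = max_orth_pairs (cji L) (arrow_rel L)"
  proof (intro equalityI subsetI)
    fix p assume p: "p \<in> max_orth_pairs (cji L) (arrow_rel L)"
    obtain X Y where "p = (X, Y)"
      by (cases p)
    with p show "p \<in> pair_of L ` carrier L"
      using max_orth_pairs_arrow_rel[of X Y] by (auto intro!: rev_image_eqI)
  qed (auto simp: pair_of_closed)
  ultimately show ?thesis
    using le weak_partial_order_axioms
      partial_order.axioms(1)[OF partial_order_Pairs[of "cji L" "arrow_rel L"]]
    by (simp add: poset_iso_def order_emb_def bij_betw_def)
qed

end

lemma (in well_separated_kappa_lattice) two_acyclic_cji:
  "two_acyclic_factorization_system (cji L) (arrow_rel L) (onto_rel L) (into_rel L)"
proof unfold_locales
  show "arrow_rel L \<subseteq> cji L \<times> cji L"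
    by (auto simp: arrow_rel_def)
  show "refl_on (cji L) (arrow_rel L)"
    by (simp add: refl_on_def arrow_rel_def not_le_kappa)
  show "Fact (cji L) (arrow_rel L) = (onto_rel L, into_rel L)"
    by (rule Fact_arrow_rel)
  \<comment> \<open>Forwards, \<open>j \<sqsubseteq> x \<sqsubseteq> kappa L z \<sqsubseteq> kappa L
    j\<close> would contradict \<open>not_le_kappa\<close>; backwards, this is well-separatedness
    for \<open>x\<close> and \<open>kappa L z\<close>.\<close>
  have iff: "(\<exists>j \<in> cji L. j \<sqsubseteq> x \<and> kappa L z \<sqsubseteq> kappa L j) \<longleftrightarrow> \<not> x \<sqsubseteq> kappa L z"
    if xz: "x \<in> cji L" "z \<in> cji L" for x z
  proof
    assume "\<exists>j \<in> cji L. j \<sqsubseteq> x \<and> kappa L z \<sqsubseteq> kappa L j"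
    then obtain j where j: "j \<in> cji L" "j \<sqsubseteq> x" "kappa L z \<sqsubseteq> kappa L j"
      by blast
    show "\<not> x \<sqsubseteq> kappa L z"
    proof
      assume "x \<sqsubseteq> kappa L z"
      then have "j \<sqsubseteq> kappa L z"
        using le_trans[OF j(2)] j xz by simp
      then have "j \<sqsubseteq> kappa L j"
        using le_trans[OF _ j(3)] j xz by simp
      with j show False
        by (simp add: not_le_kappa)
    qed
  qed (use xz well_separated[of x "kappa L z"] in simp)
  have "Mult (cji L) (onto_rel L) (into_rel L)
      = {(x, z) \<in> cji L \<times> cji L. \<exists>j \<in> cji L. j \<sqsubseteq> x \<and> kappa L z \<sqsubseteq> kappa L j}"
    by (auto simp: Mult_def onto_rel_def into_rel_def)
  also have "\<dots> = arrow_rel L"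
    by (simp add: set_eq_iff arrow_rel_def iff cong: conj_cong)
  finally show "Mult (cji L) (onto_rel L) (into_rel L) = arrow_rel L" .
  show "x = y" if "(x, y) \<in> onto_rel L" "(y, x) \<in> onto_rel L" for x y
    using that by (auto simp: onto_rel_def)
  show "x = y" if "(x, y) \<in> into_rel L" "(y, x) \<in> into_rel L" for x y
  proof -
    have xy: "x \<in> cji L" "y \<in> cji L" "kappa L x = kappa L y"
      using that by (auto simp: into_rel_def)
    then show ?thesis
      by (metis kappa_dual_kappa)
  qed
  show "x = y" if "(x, y) \<in> onto_rel L" "(y, x) \<in> into_rel L" for x y
  proof (rule ccontr)
    assume "x \<noteq> y"
    have xy: "x \<in> cji L" "y \<in> cji L" "y \<sqsubseteq> x" "kappa L x \<sqsubseteq> kappa L y"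
      using that by (auto simp: onto_rel_def into_rel_def)
    with \<open>x \<noteq> y\<close> have "y \<sqsubseteq> kappa L x"
      by (intro less_imp_le_kappa) (auto simp: lless_eq)
    then have "y \<sqsubseteq> kappa L y"
      using le_trans[OF _ xy(4)] xy by simp
    with xy show False
      by (simp add: not_le_kappa)
  qed
qed

section \<open>From factorization systems to \<open>\<kappa>\<close>-lattices\<close>

lemma cji_dual: "cji (inv_gorder L) = cmi L"
  by (simp add: cji_def cmi_def)

lemma (in partial_order) lower_cover_dual: "lower_cover (inv_gorder L) m = upper_cover L m"
proof -
  have "x \<sqsubset>\<^bsub>inv_gorder L\<^esub> m \<longleftrightarrow> m \<sqsubset> x" for x
    by (auto simp: lless_def eq_is_equal)
  then show ?thesis
    by (simp add: lower_cover_def upper_cover_def)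
qed

lemma (in complete_lattice) dual_complete_lattice: "complete_lattice (inv_gorder L)"
proof -
  interpret dual: partial_order "inv_gorder L"
    by (rule dual_order)
  show ?thesis
    by unfold_locales (simp_all add: sup_exists inf_exists)
qed

text \<open>Reversing arrows exchanges the two halves of \<open>Fact\<close> and the order of the
  factors in \<open>Mult\<close>; the brick condition turns into itself.\<close>

lemma (in two_acyclic_factorization_system) dual_system:
  "two_acyclic_factorization_system S (r\<inverse>) (into\<inverse>) (onto\<inverse>)"
proof
  show "r\<inverse> \<subseteq> S \<times> S"
    using rel_subset by auto
  show "refl_on S (r\<inverse>)"
    using rel_refl by (auto simp: refl_on_def)
  show "Fact S (r\<inverse>) = (into\<inverse>, onto\<inverse>)"
    using Fact_eq by (auto simp: Fact_def)
  show "Mult S (into\<inverse>) (onto\<inverse>) = r\<inverse>"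
    unfolding Mult_eq[symmetric] by (auto simp: Mult_def)
qed (auto dest: onto_order into_order brick)

text \<open>Isolates what the isomorphism with \<open>Pairs S r\<close> provides. The assumptions
  are self-dual, so each fact about \<open>J\<close> and joins gives one about \<open>M\<close> and
  meets.\<close>

locale lattice_representation =
  complete_lattice L + two_acyclic_factorization_system S r onto into
  for L (structure) and S r onto into +
  fixes J M :: "'b \<Rightarrow> 'a"
  assumes J_closed [simp]: "s \<in> S \<Longrightarrow> J s \<in> carrier L"
    and M_closed [simp]: "s \<in> S \<Longrightarrow> M s \<in> carrier L"
    and J_le_M: "\<lbrakk>s \<in> S; t \<in> S\<rbrakk> \<Longrightarrow> J s \<sqsubseteq> M t \<longleftrightarrow> (s, t) \<notin> r"
    and J_dense: "\<lbrakk>x \<in> carrier L; y \<in> carrier L; \<And>s. s \<in> S \<Longrightarrow> J s \<sqsubseteq> x \<Longrightarrow> J s \<sqsubseteq> y\<rbrakk>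
      \<Longrightarrow> x \<sqsubseteq> y"
    and M_dense: "\<lbrakk>x \<in> carrier L; y \<in> carrier L; \<And>s. s \<in> S \<Longrightarrow> y \<sqsubseteq> M s \<Longrightarrow> x \<sqsubseteq> M s\<rbrakk>
      \<Longrightarrow> x \<sqsubseteq> y"
begin

lemma dual_representation:
  "lattice_representation (inv_gorder L) S (r\<inverse>) (into\<inverse>) (onto\<inverse>) M J"
proof -
  interpret d1: complete_lattice "inv_gorder L"
    by (rule dual_complete_lattice)
  interpret d2: two_acyclic_factorization_system S "r\<inverse>" "into\<inverse>" "onto\<inverse>"
    by (rule dual_system)
  show ?thesis
  proof
    show "x \<sqsubseteq>\<^bsub>inv_gorder L\<^esub> y"
      if "x \<in> carrier (inv_gorder L)" "y \<in> carrier (inv_gorder L)"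
        "\<And>s. s \<in> S \<Longrightarrow> M s \<sqsubseteq>\<^bsub>inv_gorder L\<^esub> x \<Longrightarrow> M s \<sqsubseteq>\<^bsub>inv_gorder L\<^esub> y" for x y
      using that M_dense[of y x] by simp
    show "x \<sqsubseteq>\<^bsub>inv_gorder L\<^esub> y"
      if "x \<in> carrier (inv_gorder L)" "y \<in> carrier (inv_gorder L)"
        "\<And>s. s \<in> S \<Longrightarrow> y \<sqsubseteq>\<^bsub>inv_gorder L\<^esub> J s \<Longrightarrow> x \<sqsubseteq>\<^bsub>inv_gorder L\<^esub> J s" for x y
      using that J_dense[of y x] by simp
  qed (simp_all add: J_le_M)
qed

text \<open>\<open>J_le_M\<close> turns the clause of \<open>Fact\<close> into a comparison of the
  elements \<open>M z\<close> above \<open>J s\<close> and above \<open>J t\<close>, which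
  \<open>M_dense\<close> reduces to the order.\<close>

lemma onto_iff:
  assumes "s \<in> S" "t \<in> S"
  shows "(s, t) \<in> onto \<longleftrightarrow> J t \<sqsubseteq> J s"
proof -
  have "(s, t) \<in> onto \<longleftrightarrow> (\<forall>z \<in> S. (t, z) \<in> r \<longrightarrow> (s, z) \<in> r)"
    using Fact_eq assms by (auto simp: Fact_def)
  also have "\<dots> \<longleftrightarrow> (\<forall>z \<in> S. J s \<sqsubseteq> M z \<longrightarrow> J t \<sqsubseteq> M z)"
    using assms J_le_M by auto
  also have "\<dots> \<longleftrightarrow> J t \<sqsubseteq> J s"
  proof
    assume "\<forall>z \<in> S. J s \<sqsubseteq> M z \<longrightarrow> J t \<sqsubseteq> M z"
    then show "J t \<sqsubseteq> J s"
      using assms J_closed M_dense[of "J t" "J s"] by blast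
  next
    assume "J t \<sqsubseteq> J s"
    then show "\<forall>z \<in> S. J s \<sqsubseteq> M z \<longrightarrow> J t \<sqsubseteq> M z"
      using assms le_trans[of "J t" "J s"] by simp
  qed
  finally show ?thesis .
qed

lemma into_iff:
  assumes "s \<in> S" "t \<in> S"
  shows "(s, t) \<in> into \<longleftrightarrow> M t \<sqsubseteq> M s"
  using lattice_representation.onto_iff[OF dual_representation, of t s] assms by simp

lemma interpolation:
  assumes "(s, t) \<in> r"
  obtains u where "u \<in> S" "J u \<sqsubseteq> J s" "M t \<sqsubseteq> M u"
proof -
  obtain u where "s \<in> S" "t \<in> S" "u \<in> S" "(s, u) \<in> onto" "(u, t) \<in> into"
    using assms Mult_eq by (auto simp: Mult_def)
  then show thesis
    using that onto_iff into_iff by blast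
qed

lemma brick_le:
  assumes "s \<in> S" "t \<in> S" "J t \<sqsubseteq> J s" "M s \<sqsubseteq> M t"
  shows "t = s"
  using assms brick[of s t] by (simp add: onto_iff into_iff)

lemma not_J_le_M: "s \<in> S \<Longrightarrow> \<not> J s \<sqsubseteq> M s"
  using rel_refl by (simp add: J_le_M refl_on_def)

lemma inj_J: "inj_on J S"
proof (rule inj_onI)
  fix s t assume "s \<in> S" "t \<in> S" "J s = J t"
  then show "s = t"
    using onto_iff[of s t] onto_iff[of t s] by (simp add: onto_order)
qed

text \<open>By \<open>J_dense\<close> it suffices to treat each \<open>J t\<close> below
  \<open>x\<close>. If \<open>t\<close> were related to \<open>s\<close>, the interpolant
  \<open>u\<close> would satisfy \<open>J u \<sqsubseteq> x \<sqsubseteq> J s\<close> and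
  \<open>M s \<sqsubseteq> M u\<close>; the brick condition gives \<open>u = s\<close>, hence
  \<open>x = J s\<close>.\<close>

lemma less_J_imp_le_M:
  assumes s: "s \<in> S" and x: "x \<in> carrier L" "x \<sqsubseteq> J s" "x \<noteq> J s"
  shows "x \<sqsubseteq> M s"
proof (rule J_dense)
  fix t assume t: "t \<in> S" "J t \<sqsubseteq> x"
  show "J t \<sqsubseteq> M s"
  proof (rule ccontr)
    assume "\<not> J t \<sqsubseteq> M s"
    then have "(t, s) \<in> r"
      using s t J_le_M by blast
    then obtain u where u: "u \<in> S" "J u \<sqsubseteq> J t" "M s \<sqsubseteq> M u"
      by (rule interpolation)
    have ux: "J u \<sqsubseteq> x"
      using le_trans[OF u(2) t(2)] u t x by simp
    then have "J u \<sqsubseteq> J s"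
      using le_trans[OF ux x(2)] u s x by simp
    then have "u = s"
      using brick_le s u by blast
    with ux x s show False
      by auto
  qed
qed (use s x in auto)

lemma less_J_iff:
  assumes "s \<in> S" "x \<in> carrier L"
  shows "x \<sqsubset> J s \<longleftrightarrow> x \<sqsubseteq> J s \<sqinter> M s"
proof
  assume "x \<sqsubset> J s"
  then show "x \<sqsubseteq> J s \<sqinter> M s"
    using assms less_J_imp_le_M by (auto simp: lless_eq intro: meet_le)
next
  assume "x \<sqsubseteq> J s \<sqinter> M s"
  then have "x \<sqsubseteq> J s" "x \<sqsubseteq> M s"
    using assms meet_left[of "J s" "M s"] meet_right[of "J s" "M s"] le_trans[of x "J s \<sqinter> M s"]
    by auto
  then show "x \<sqsubset> J s"
    using assms not_J_le_M by (auto simp: lless_eq)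
qed

lemma lower_cover_J: "s \<in> S \<Longrightarrow> lower_cover L (J s) = J s \<sqinter> M s"
  by (rule lower_cover_eqI) (auto simp: less_J_iff)

text \<open>If \<open>J s\<close> were the join of a set not containing it, all members would lie
  strictly below \<open>J s\<close>, hence below \<open>M s\<close>, and so would
  \<open>J s\<close>.\<close>

lemma J_in_cji:
  assumes s: "s \<in> S"
  shows "J s \<in> cji L"
proof -
  have "J s \<in> X" if X: "X \<subseteq> carrier L" "J s = \<Squnion>X" for X
  proof (rule ccontr)
    assume nX: "J s \<notin> X"
    have "x \<sqsubseteq> M s" if "x \<in> X" for x
      using that nX X s sup_upper[OF X(1) that] by (intro less_J_imp_le_M) auto
    then have "J s \<sqsubseteq> M s"
      using X s sup_least[OF X(1), of "M s"] by simp
    with s show False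
      by (simp add: not_J_le_M)
  qed
  with s show ?thesis
    by (simp add: cji_def)
qed

lemma sup_J_below:
  assumes "x \<in> carrier L"
  shows "x = \<Squnion>(J ` {s \<in> S. J s \<sqsubseteq> x})"
proof (rule le_antisym)
  let ?X = "J ` {s \<in> S. J s \<sqsubseteq> x}"
  have X: "?X \<subseteq> carrier L"
    by auto
  show "\<Squnion>?X \<in> carrier L"
    by (rule sup_closed[OF X])
  then show "x \<sqsubseteq> \<Squnion>?X"
    using assms sup_upper[OF X] by - (rule J_dense, auto)
  show "\<Squnion>?X \<sqsubseteq> x"
    using X assms by (intro sup_least) auto
qed (fact assms)

text \<open>A completely join-irreducible element is the join of the \<open>J s\<close> below it, so
  it must be one of them.\<close>

lemma cji_eq: "cji L = J ` S"
proof
  show "cji L \<subseteq> J ` S"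
  proof
    fix j assume j: "j \<in> cji L"
    then have "j = \<Squnion>(J ` {s \<in> S. J s \<sqsubseteq> j})"
      by (intro sup_J_below) (simp add: cji_def)
    moreover have "J ` {s \<in> S. J s \<sqsubseteq> j} \<subseteq> carrier L"
      by auto
    ultimately have "j \<in> J ` {s \<in> S. J s \<sqsubseteq> j}"
      using j unfolding cji_def by blast
    then show "j \<in> J ` S"
      by blast
  qed
qed (auto simp: J_in_cji)

text \<open>Every element above the lower cover of \<open>J s\<close> is above \<open>J s\<close> or
  below \<open>M s\<close>; this makes \<open>M s\<close> the maximum required of
  \<open>kappa\<close>.\<close>

lemma J_le_or_le_M:
  assumes s: "s \<in> S" and y: "y \<in> carrier L" "J s \<sqinter> M s \<sqsubseteq> y" and nle: "\<not> J s \<sqsubseteq> y"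
  shows "y \<sqsubseteq> M s"
proof -
  obtain u where u: "u \<in> S" "y \<sqsubseteq> M u" "\<not> J s \<sqsubseteq> M u"
    using M_dense[of "J s" y] s y nle by auto
  then have "(s, u) \<in> r"
    using s J_le_M by blast
  then obtain v where v: "v \<in> S" "J v \<sqsubseteq> J s" "M u \<sqsubseteq> M v"
    by (rule interpolation)
  \<comment> \<open>Otherwise \<open>J v\<close> lies below the lower cover of \<open>J s\<close>,
    so \<open>J v \<sqsubseteq> y \<sqsubseteq> M u \<sqsubseteq> M v\<close>, against
    reflexivity.\<close>
  have "v = s"
  proof (rule ccontr)
    assume "v \<noteq> s"
    then have "J v \<sqsubset> J s"
      using v s inj_J by (auto simp: lless_eq inj_on_eq_iff)
    then have "J v \<sqsubseteq> J s \<sqinter> M s"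
      using s v by (simp add: less_J_iff)
    then have "J v \<sqsubseteq> M v"
      using le_trans y u v s by (meson J_closed M_closed meet_closed)
    with v show False
      by (simp add: not_J_le_M)
  qed
  then show ?thesis
    using le_trans[OF u(2) v(3)] u v y by simp
qed

lemma greatest_M:
  assumes s: "s \<in> S"
  shows "greatest L (M s) {y \<in> carrier L. J s \<sqinter> y = lower_cover L (J s)}"
proof -
  have "y \<sqsubseteq> M s" if y: "y \<in> carrier L" and eq: "J s \<sqinter> y = J s \<sqinter> M s" for y
  proof (rule J_le_or_le_M)
    show "J s \<sqinter> M s \<sqsubseteq> y"
      using s y meet_right[of "J s" y] by (simp add: eq)
    show "\<not> J s \<sqsubseteq> y"
    proof
      assume "J s \<sqsubseteq> y"
      then have "J s \<sqsubseteq> J s \<sqinter> M s"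
        using s y meet_le[of "J s" "J s" y] by (simp add: eq)
      then have "J s \<sqsubset> J s"
        using s less_J_iff by simp
      then show False
        by (simp add: lless_eq)
    qed
  qed (use s y in auto)
  with s show ?thesis
    by (auto simp: greatest_def lower_cover_J)
qed

section \<open>Dual facts, and kappa as the map from \<open>J s\<close> to
  \<open>M s\<close>\<close>

lemma inj_M: "inj_on M S"
  by (rule lattice_representation.inj_J[OF dual_representation])

lemma cmi_eq: "cmi L = M ` S"
  using lattice_representation.cji_eq[OF dual_representation] by (simp only: cji_dual)

lemma inf_M_above: "x \<in> carrier L \<Longrightarrow> x = \<Sqinter>(M ` {s \<in> S. x \<sqsubseteq> M s})"
  using lattice_representation.sup_J_below[OF dual_representation, of x] by simp

lemma least_J:
  "s \<in> S \<Longrightarrow> least L (J s) {x \<in> carrier L. M s \<squnion> x = upper_cover L (M s)}"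
  using lattice_representation.greatest_M[OF dual_representation, of s]
  by (simp add: lower_cover_dual)

lemma kappa_J: "s \<in> S \<Longrightarrow> kappa L (J s) = M s"
  unfolding kappa_def by (rule the_equality) (auto intro: greatest_M greatest_unique)

lemma kappa_bijections_representation:
  "kappa_bijections L (M \<circ> the_inv_into S J) (J \<circ> the_inv_into S M)"
proof -
  have J: "bij_betw J S (cji L)" and M: "bij_betw M S (cmi L)"
    using inj_J inj_M by (auto simp: bij_betw_def cji_eq cmi_eq)
  have "bij_betw (M \<circ> the_inv_into S J) (cji L) (cmi L)"
    "bij_betw (J \<circ> the_inv_into S M) (cmi L) (cji L)"
    by (rule bij_betw_trans[OF bij_betw_the_inv_into[OF J] M]
        bij_betw_trans[OF bij_betw_the_inv_into[OF M] J])+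
  then show ?thesis
    unfolding kappa_bijections_def
    by (auto simp: cji_eq cmi_eq the_inv_into_f_f inj_J inj_M greatest_M least_J)
qed

lemma well_separated_kappa_lattice: "well_separated_kappa_lattice L"
proof
  show "\<exists>X \<subseteq> cji L. x = \<Squnion>X" if "x \<in> carrier L" for x
    using sup_J_below[OF that] by (intro exI[of _ "J ` {s \<in> S. J s \<sqsubseteq> x}"]) (auto simp: cji_eq)
  show "\<exists>X \<subseteq> cmi L. x = \<Sqinter>X" if "x \<in> carrier L" for x
    using inf_M_above[OF that] by (intro exI[of _ "M ` {s \<in> S. x \<sqsubseteq> M s}"]) (auto simp: cmi_eq)
  show "\<exists>k kd. kappa_bijections L k kd"
    using kappa_bijections_representation by blast
  show "\<exists>j \<in> cji L. j \<sqsubseteq> x \<and> y \<sqsubseteq> kappa L j"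
    if xy: "x \<in> carrier L" "y \<in> carrier L" "\<not> x \<sqsubseteq> y" for x y
  proof -
    obtain s where s: "s \<in> S" "J s \<sqsubseteq> x" "\<not> J s \<sqsubseteq> y"
      using J_dense xy by blast
    \<comment> \<open>Density on both sides places an arrow from \<open>s\<close> to
      \<open>t\<close> between \<open>x\<close> and \<open>y\<close>; its interpolant
      \<open>u\<close> supplies the separating element \<open>J u\<close>, with
      \<open>kappa L (J u) = M u\<close>.\<close>
    obtain t where t: "t \<in> S" "y \<sqsubseteq> M t" "\<not> J s \<sqsubseteq> M t"
      using M_dense[of "J s" y] xy s by auto
    then have "(s, t) \<in> r"
      using s J_le_M by blast
    then obtain u where u: "u \<in> S" "J u \<sqsubseteq> J s" "M t \<sqsubseteq> M u"
      by (rule interpolation)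
    have "J u \<sqsubseteq> x" "y \<sqsubseteq> M u"
      using le_trans[OF u(2) s(2)] le_trans[OF t(2) u(3)] xy s t u by auto
    with u show ?thesis
      by (auto simp: cji_eq kappa_J)
  qed
qed

lemma system_isomorphic_cji:
  "system_isomorphic (S, r, onto, into) (cji L, arrow_rel L, onto_rel L, into_rel L)"
proof -
  have "bij_betw J S (cji L)"
    by (simp add: bij_betw_def inj_J cji_eq)
  moreover have "rel_preserving J S r (arrow_rel L)" "rel_preserving J S onto (onto_rel L)"
    "rel_preserving J S into (into_rel L)"
    by (auto simp: rel_preserving_def arrow_rel_def onto_rel_def into_rel_def J_in_cji kappa_J
        J_le_M onto_iff into_iff)
  ultimately show ?thesis
    by (auto simp: system_isomorphic_def)
qed

end

section \<open>Completeness and the representation of a poset isomorphic to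
  \<open>Pairs S r\<close>\<close>

lemma complete_lattice_if_poset_iso_Pairs:
  assumes "partial_order L" "poset_iso L (Pairs S r) f"
  shows "complete_lattice L"
proof -
  interpret partial_order L
    by fact
  let ?p = "\<lambda>X. (left_perp S r (right_perp S r X), right_perp S r X)"
  have le: "x \<sqsubseteq>\<^bsub>L\<^esub> y \<longleftrightarrow> fst (f x) \<subseteq> fst (f y)" if "x \<in> carrier L" "y \<in> carrier L" for x y
    using assms(2) that by (auto simp: poset_iso_def order_emb_def)
  have f: "f x \<in> max_orth_pairs S r" if "x \<in> carrier L" for x
    using assms(2) that by (auto simp: poset_iso_def bij_betw_def)
  \<comment> \<open>First components are closed sets, so the closure of \<open>X\<close> is the
    least one containing \<open>X\<close>. Joins below are closures of unions.\<close>
  have cl: "left_perp S r (right_perp S r X) \<subseteq> fst (f x)" if "X \<subseteq> fst (f x)" "x \<in> carrier L" for X x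
  proof -
    have "left_perp S r (right_perp S r X) \<subseteq> left_perp S r (right_perp S r (fst (f x)))"
      by (intro left_perp_antimono right_perp_antimono that(1))
    then show ?thesis
      by (simp only: max_orth_pairs_closed[OF f[OF that(2)]])
  qed
  have ex: "\<exists>x \<in> carrier L. fst (f x) = left_perp S r (right_perp S r X)" if "X \<subseteq> S" for X
  proof -
    have "?p X \<in> f ` carrier L"
      using assms(2) max_orth_pair_generated[OF that, of r] by (simp add: poset_iso_def bij_betw_def)
    then show ?thesis
      by (metis fst_conv imageE)
  qed
  show ?thesis
  proof
    fix A assume A: "A \<subseteq> carrier L"
    let ?B = "\<Union>a \<in> A. fst (f a)"
    have B: "?B \<subseteq> S"
      using A f max_orth_pairsD(1) by blast
    obtain x where x: "x \<in> carrier L" "fst (f x) = left_perp S r (right_perp S r ?B)"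
      using ex[OF B] by blast
    have "is_lub L x A"
    proof (rule least_UpperI)
      show "a \<sqsubseteq>\<^bsub>L\<^esub> x" if "a \<in> A" for a
        using that A x subset_left_perp_right_perp[OF B, of r] by (subst le) auto
      show "x \<sqsubseteq>\<^bsub>L\<^esub> y" if "y \<in> Upper L A" for y
      proof -
        have y: "y \<in> carrier L" "\<And>a. a \<in> A \<Longrightarrow> a \<sqsubseteq>\<^bsub>L\<^esub> y"
          using that A by (auto simp: Upper_def)
        then have "?B \<subseteq> fst (f y)"
          using A le by blast
        then show ?thesis
          using cl x y le by auto
      qed
    qed (use A x in auto)
    then show "\<exists>s. is_lub L s A" ..
  next
    fix A assume A: "A \<subseteq> carrier L"
    \<comment> \<open>Intersecting with \<open>S\<close> matters for empty \<open>A\<close>, where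
      the inner intersection is the whole type.\<close>
    let ?B = "S \<inter> (\<Inter>a \<in> A. fst (f a))"
    have B: "?B \<subseteq> S"
      by blast
    obtain x where x: "x \<in> carrier L" "fst (f x) = left_perp S r (right_perp S r ?B)"
      using ex[OF B] by blast
    have "is_glb L x A"
    proof (rule greatest_LowerI)
      show "x \<sqsubseteq>\<^bsub>L\<^esub> a" if "a \<in> A" for a
      proof -
        have "a \<in> carrier L" "?B \<subseteq> fst (f a)"
          using that A by auto
        then show ?thesis
          using cl x le by auto
      qed
      show "y \<sqsubseteq>\<^bsub>L\<^esub> x" if "y \<in> Lower L A" for y
      proof -
        have y: "y \<in> carrier L" "\<And>a. a \<in> A \<Longrightarrow> y \<sqsubseteq>\<^bsub>L\<^esub> a"
          using that A by (auto simp: Lower_def)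
        then have "fst (f y) \<subseteq> ?B"
          using A le f max_orth_pairsD(1) by blast
        then have "fst (f y) \<subseteq> fst (f x)"
          unfolding x(2) by (rule subset_trans[OF _ subset_left_perp_right_perp[OF B]])
        then show ?thesis
          using le[OF y(1) x(1)] by simp
      qed
    qed (use A x in auto)
    then show "\<exists>i. is_glb L i A" ..
  qed
qed

lemma lattice_representation_if_poset_isomorphic_Pairs:
  assumes "partial_order L" "two_acyclic_factorization_system S r onto into"
    "poset_isomorphic L (Pairs S r)"
  shows "\<exists>J M. lattice_representation L S r onto into J M"
proof -
  obtain f where iso: "poset_iso L (Pairs S r) f"
    using assms(3) by (auto simp: poset_isomorphic_def)
  interpret complete_lattice L
    by (rule complete_lattice_if_poset_iso_Pairs[OF assms(1) iso])
  interpret two_acyclic_factorization_system S r onto into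
    by fact
  have le: "x \<sqsubseteq>\<^bsub>L\<^esub> y \<longleftrightarrow> fst (f x) \<subseteq> fst (f y)" if "x \<in> carrier L" "y \<in> carrier L" for x y
    using iso that by (auto simp: poset_iso_def order_emb_def)
  have f: "f x \<in> max_orth_pairs S r" if "x \<in> carrier L" for x
    using iso that by (auto simp: poset_iso_def bij_betw_def)
  \<comment> \<open>The element of \<open>L\<close> whose pair is generated by \<open>X\<close> on
    the left.\<close>
  define g where "g X = inv_into (carrier L) f (left_perp S r (right_perp S r X), right_perp S r X)"
    for X
  have g: "g X \<in> carrier L" "fst (f (g X)) = left_perp S r (right_perp S r X)" if "X \<subseteq> S" for X
  proof -
    have img: "(left_perp S r (right_perp S r X), right_perp S r X) \<in> f ` carrier L"
      using iso max_orth_pair_generated[OF that, of r] by (simp add: poset_iso_def bij_betw_def)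
    show "g X \<in> carrier L" "fst (f (g X)) = left_perp S r (right_perp S r X)"
      unfolding g_def using inv_into_into[OF img] f_inv_into_f[OF img] by auto
  qed
  define J where "J s = g {s}" for s
  \<comment> \<open>The set \<open>left_perp S r {t}\<close> is already closed, so
    \<open>M t\<close> corresponds to the pair generated by \<open>{t}\<close> on the right.\<close>
  define M where "M t = g (left_perp S r {t})" for t
  have J: "J s \<in> carrier L" if "s \<in> S" for s
    using g that by (simp add: J_def)
  have M: "M t \<in> carrier L" for t
    unfolding M_def by (intro g) (auto simp: left_perp_def)
  \<comment> \<open>The \<open>J s\<close> below \<open>x\<close> read off the first component of
    its pair, and by \<open>le_M\<close> the \<open>M t\<close> above \<open>x\<close> read off the
    second. Both density assumptions follow from this.\<close>
  have J_le: "J s \<sqsubseteq>\<^bsub>L\<^esub> x \<longleftrightarrow> s \<in> fst (f x)" if s: "s \<in> S" and x: "x \<in> carrier L" for s x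
  proof -
    have "J s \<sqsubseteq>\<^bsub>L\<^esub> x \<longleftrightarrow> left_perp S r (right_perp S r {s}) \<subseteq> left_perp S r (right_perp S r (fst (f x)))"
      using le[OF J x] g[of "{s}"] s by (simp add: J_def max_orth_pairs_closed[OF f[OF x]])
    also have "\<dots> \<longleftrightarrow> s \<in> left_perp S r (right_perp S r (fst (f x)))"
      using s by (auto simp: left_perp_def right_perp_def)
    finally show ?thesis
      by (simp only: max_orth_pairs_closed[OF f[OF x]])
  qed
  have fst_M: "fst (f (M t)) = left_perp S r {t}" if "t \<in> S" for t
  proof -
    have "fst (f (M t)) = left_perp S r (right_perp S r (left_perp S r {t}))"
      unfolding M_def by (intro g) (auto simp: left_perp_def)
    also have "\<dots> = left_perp S r {t}"
      using that by (auto simp: left_perp_def right_perp_def)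
    finally show ?thesis .
  qed
  have le_M: "x \<sqsubseteq>\<^bsub>L\<^esub> M t \<longleftrightarrow> t \<in> snd (f x)" if "t \<in> S" and x: "x \<in> carrier L" for t x
  proof -
    have "x \<sqsubseteq>\<^bsub>L\<^esub> M t \<longleftrightarrow> fst (f x) \<subseteq> left_perp S r {t}"
      using that le[OF x M] by (simp add: fst_M)
    also have "\<dots> \<longleftrightarrow> t \<in> right_perp S r (fst (f x))"
      using that max_orth_pairsD(1)[OF f[OF x]] by (auto simp: left_perp_def right_perp_def)
    finally show ?thesis
      by (simp only: max_orth_pairsD(3)[OF f[OF x]])
  qed
  have "lattice_representation L S r onto into J M"
  proof
    show "J s \<in> carrier L" "M s \<in> carrier L" if "s \<in> S" for s
      using J M that by auto
    show "J s \<sqsubseteq>\<^bsub>L\<^esub> M t \<longleftrightarrow> (s, t) \<notin> r" if "s \<in> S" "t \<in> S" for s t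
      using J_le[OF that(1) M] fst_M that by (simp add: left_perp_def)
    show "x \<sqsubseteq>\<^bsub>L\<^esub> y"
      if xy: "x \<in> carrier L" "y \<in> carrier L" "\<And>s. s \<in> S \<Longrightarrow> J s \<sqsubseteq>\<^bsub>L\<^esub> x \<Longrightarrow> J s \<sqsubseteq>\<^bsub>L\<^esub> y" for x y
    proof -
      have "fst (f x) \<subseteq> fst (f y)"
      proof
        fix s assume s: "s \<in> fst (f x)"
        then have "s \<in> S"
          using max_orth_pairsD(1)[OF f[OF xy(1)]] by blast
        with s show "s \<in> fst (f y)"
          using xy(3)[of s] by (simp add: J_le xy)
      qed
      then show ?thesis
        by (simp add: le xy)
    qed
    show "x \<sqsubseteq>\<^bsub>L\<^esub> y"
      if xy: "x \<in> carrier L" "y \<in> carrier L" "\<And>s. s \<in> S \<Longrightarrow> y \<sqsubseteq>\<^bsub>L\<^esub> M s \<Longrightarrow> x \<sqsubseteq>\<^bsub>L\<^esub> M s" for x y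
    proof -
      have "snd (f y) \<subseteq> snd (f x)"
      proof
        fix s assume s: "s \<in> snd (f y)"
        then have "s \<in> S"
          using max_orth_pairsD(2)[OF f[OF xy(2)]] by blast
        with s show "s \<in> snd (f x)"
          using xy(3)[of s] by (simp add: le_M xy)
      qed
      \<comment> \<open>The order compares first components, which are the left perps of the second
        ones; inclusion is reversed.\<close>
      then have "left_perp S r (snd (f x)) \<subseteq> left_perp S r (snd (f y))"
        by (rule left_perp_antimono)
      then show ?thesis
        by (simp only: le[OF xy(1,2)] max_orth_pairsD(4)[OF f, symmetric] xy)
    qed
  qed
  then show ?thesis
    by blast
qed

lemma system_of_poset_isomorphic_Pairs:
  assumes "partial_order L" "two_acyclic_factorization_system S r onto into"
    "poset_isomorphic L (Pairs S r)"
  shows "well_separated_kappa_lattice L"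
    and "system_isomorphic (S, r, onto, into) (cji L, arrow_rel L, onto_rel L, into_rel L)"
proof -
  obtain J M where "lattice_representation L S r onto into J M"
    using lattice_representation_if_poset_isomorphic_Pairs[OF assms] by blast
  then interpret lattice_representation L S r onto into J M .
  show "well_separated_kappa_lattice L"
    and "system_isomorphic (S, r, onto, into) (cji L, arrow_rel L, onto_rel L, into_rel L)"
    by (rule well_separated_kappa_lattice system_isomorphic_cji)+
qed

text \<open>The system built from \<open>L\<close> lives on \<open>cji L\<close>, so the existential
  may range over subsets of \<open>'a\<close>. The second conjunct covers systems on an arbitrary
  type \<open>'b\<close>, and so gives the backward implication at every type.\<close>

theorem theorem1p4:
  fixes L :: "('a, 'm) gorder_scheme"
  assumes "partial_order L"
  shows
    "(well_separated_kappa_lattice L \<longleftrightarrow>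
       (\<exists>(S :: 'a set) r onto into.
          two_acyclic_factorization_system S r onto into \<and> poset_isomorphic L (Pairs S r)))
   \<and> (\<forall>(S :: 'b set) r onto into.
        two_acyclic_factorization_system S r onto into \<and> poset_isomorphic L (Pairs S r) \<longrightarrow>
          well_separated_kappa_lattice L \<and>
          system_isomorphic (S, r, onto, into) (cji L, arrow_rel L, onto_rel L, into_rel L))
   \<and> (well_separated_kappa_lattice L \<longrightarrow>
        poset_iso L (Pairs (cji L) (arrow_rel L)) (pair_of L)
      \<and> (\<forall>x \<in> carrier L. \<Squnion>\<^bsub>L\<^esub>(fst (pair_of L x)) = x)
      \<and> (\<forall>(X, Y) \<in> carrier (Pairs (cji L) (arrow_rel L)).
           \<Squnion>\<^bsub>L\<^esub>X \<in> carrier L \<and> pair_of L (\<Squnion>\<^bsub>L\<^esub>X) = (X, Y) \<and>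
           \<Squnion>\<^bsub>L\<^esub>X = \<Sqinter>\<^bsub>L\<^esub>(kappa L ` Y)))"
proof -
  have forth: "two_acyclic_factorization_system (cji L) (arrow_rel L) (onto_rel L) (into_rel L)
      \<and> poset_iso L (Pairs (cji L) (arrow_rel L)) (pair_of L)
      \<and> (\<forall>x \<in> carrier L. \<Squnion>\<^bsub>L\<^esub>(fst (pair_of L x)) = x)
      \<and> (\<forall>(X, Y) \<in> carrier (Pairs (cji L) (arrow_rel L)).
           \<Squnion>\<^bsub>L\<^esub>X \<in> carrier L \<and> pair_of L (\<Squnion>\<^bsub>L\<^esub>X) = (X, Y) \<and>
           \<Squnion>\<^bsub>L\<^esub>X = \<Sqinter>\<^bsub>L\<^esub>(kappa L ` Y))"
    if "well_separated_kappa_lattice L"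
  proof -
    interpret well_separated_kappa_lattice L
      by fact
    have "\<Squnion>\<^bsub>L\<^esub>(fst (pair_of L x)) = x" if "x \<in> carrier L" for x
      using that by (simp add: pair_of_eq sup_cji_below)
    moreover have "\<forall>(X, Y) \<in> carrier (Pairs (cji L) (arrow_rel L)).
        \<Squnion>\<^bsub>L\<^esub>X \<in> carrier L \<and> pair_of L (\<Squnion>\<^bsub>L\<^esub>X) = (X, Y) \<and> \<Squnion>\<^bsub>L\<^esub>X = \<Sqinter>\<^bsub>L\<^esub>(kappa L ` Y)"
      unfolding carrier_Pairs using max_orth_pairs_arrow_rel by blast
    ultimately show ?thesis
      using two_acyclic_cji poset_iso_pair_of by blast
  qed
  show ?thesis
  proof (intro conjI)
    show "well_separated_kappa_lattice L \<longleftrightarrow>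
        (\<exists>(S :: 'a set) r onto into.
          two_acyclic_factorization_system S r onto into \<and> poset_isomorphic L (Pairs S r))"
    proof
      assume "well_separated_kappa_lattice L"
      then show "\<exists>(S :: 'a set) r onto into.
          two_acyclic_factorization_system S r onto into \<and> poset_isomorphic L (Pairs S r)"
        using forth unfolding poset_isomorphic_def by blast
    qed (use system_of_poset_isomorphic_Pairs(1)[OF assms] in blast)
    show "\<forall>(S :: 'b set) r onto into.
        two_acyclic_factorization_system S r onto into \<and> poset_isomorphic L (Pairs S r) \<longrightarrow>
          well_separated_kappa_lattice L \<and>
          system_isomorphic (S, r, onto, into) (cji L, arrow_rel L, onto_rel L, into_rel L)"
      using system_of_poset_isomorphic_Pairs[OF assms] by blast
  qed (use forth in simp_all)
qed

end
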